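(* Let $p,q$ be primes with $p\equiv 1\pmod 8$ and $q\equiv 5\pmod 8$, and suppose that $p$ is a quadratic nonresidue of $q$. Then there exist positive integers $x,y,z$ with $\gcd(pqx,y)=1$ and $(pqx^2)^2+y^4=z^2$ if and only if there exist positive integers $x,y,z$ with $\gcd(x,y)=1$ and $pqz^2=x^4+y^4$.
   Context: "$p$ is a quadratic nonresidue of $q$" means that $q\nmid p$ and the congruence $t^2\equiv p\pmod q$ has no integer solution $t$. *)

theory Defs
  imports "HOL-Number_Theory.Number_Theory"
begin

definition quadratic_nonresidue :: "int \<Rightarrow> int \<Rightarrow> bool" where
  "quadratic_nonresidue q a \<longleftrightarrow> \<not> q dvd a \<and> \<not> QuadRes q a"

end

theory Submission
  imports Defs "HOL-Computational_Algebra.Nth_Powers"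
begin

text \<open>
  Both sides of the equivalence are false. A prime \<open>q\<close> with \<open>q \<equiv> 5 (mod 8)\<close> cannot divide
  \<open>x\<^sup>4 + y\<^sup>4\<close> with \<open>x\<close>, \<open>y\<close> coprime, since \<open>-1\<close> is not a fourth power modulo \<open>q\<close>.
  For \<open>(pqx\<^sup>2)\<^sup>2 + y\<^sup>4 = z\<^sup>2\<close> we use infinite descent on \<open>x\<close>. An even \<open>y\<close> is excluded modulo \<open>8\<close>.
  For odd \<open>y\<close>, parametrising Pythagorean triples twice gives
  \<open>pq(x/2)\<^sup>2 = rs(r\<^sup>2 + s\<^sup>2)\<close> with pairwise coprime factors, so that \<open>r = au\<^sup>2\<close>, \<open>s = bv\<^sup>2\<close>,
  \<open>r\<^sup>2 + s\<^sup>2 = ct\<^sup>2\<close> with \<open>abc = pq\<close>. If \<open>c \<noteq> 1\<close>, this is impossible because \<open>p\<close> and \<open>q\<close> are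
  nonresidues of each other (for \<open>c = p, q\<close>) or by the fourth power argument (for \<open>c = pq\<close>).
  If \<open>c = 1\<close> and \<open>{a, b} = {p, q}\<close>, one more parametrisation contradicts nonresiduosity,
  and \<open>{a, b} = {1, pq}\<close> is a smaller solution of the original equation.
\<close>

section \<open>Coprime factorisations and Pythagorean triples\<close>

text \<open>Since \<open>k\<close> divides \<open>r * s\<close>, it splits as \<open>c * d\<close>
  with \<open>c dvd r\<close> and \<open>d dvd s\<close>. The cofactors are then coprime with
  product \<open>w^2\<close>, hence squares.\<close>

lemma coprime_mult_eq_mult_square:
  fixes r s k w :: nat
  assumes "coprime r s" "r * s = k * w^2" "r > 0" "s > 0"
  obtains c d a b where "k = c * d" "r = c * a^2" "s = d * b^2"
proof -
  have "k dvd r * s" using assms(2) by simp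
  then obtain c d where cd: "k = c * d" "c dvd r" "d dvd s"
    using division_decomp by blast
  then obtain r' s' where rs: "r = c * r'" "s = d * s'" by (auto simp: dvd_def)
  have "k * (r' * s') = k * w^2" using assms(2) cd rs by (simp add: ac_simps)
  moreover have "k > 0" using assms rs cd by auto
  ultimately have "r' * s' = w^2" by simp
  moreover have "coprime r' s'" using assms(1) rs by simp
  ultimately have "is_nth_power 2 r'" "is_nth_power 2 s'"
    using is_nth_power_mult_coprime_nat_iff[of r' s' 2] by auto
  then obtain a b where "r' = a^2" "s' = b^2" by (auto simp: is_nth_power_def)
  then show ?thesis using that cd rs by blast
qed

lemma coprime_add_self_nat: "coprime (a + b) b \<longleftrightarrow> coprime a (b::nat)"
  by (metis coprime_iff_gcd_eq_1 gcd_add1)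

lemma square_mod_4_nat: "(n::nat)^2 mod 4 = (if even n then 0 else 1)"
proof (cases "even n")
  case True
  then show ?thesis by (auto elim!: evenE simp: power_mult_distrib)
next
  case False
  then obtain k where "n = 2 * k + 1" by (rule oddE)
  then have "n^2 = 4 * (k * k + k) + 1" by (simp add: power2_eq_square algebra_simps)
  then have "n^2 mod 4 = 1" by presburger
  then show ?thesis using False by simp
qed

lemma odd_square_mod_8_nat:
  assumes "odd (n::nat)"
  shows "n^2 mod 8 = 1"
proof -
  obtain k where k: "n = 2 * k + 1" using assms by (rule oddE)
  have "even (k * (k + 1))" by simp
  then obtain j where "k * (k + 1) = 2 * j" by (rule evenE)
  then have "n^2 = 8 * j + 1" using k by (simp add: power2_eq_square algebra_simps)
  then show ?thesis by simp
qed

text \<open>Modulo 4, \<open>b\<close> is even and \<open>c\<close> odd. Halving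
  \<open>c + a\<close> and \<open>c - a\<close> gives coprime numbers with product
  \<open>(b/2)^2\<close>, so both are squares. The form \<open>a + n^2 = m^2\<close> avoids
  truncated subtraction.\<close>

lemma primitive_pythagorean_triple:
  fixes a b c :: nat
  assumes "a^2 + b^2 = c^2" "coprime a b" "odd a" "b > 0"
  obtains m n where "coprime m n" "n > 0" "a + n^2 = m^2" "b = 2 * m * n" "c = m^2 + n^2"
proof -
  have "even b"
  proof (rule ccontr)
    assume "odd b"
    then have "(a^2 + b^2) mod 4 = 2"
      using square_mod_4_nat[of a] square_mod_4_nat[of b] assms(3) by presburger
    then show False using assms(1) square_mod_4_nat[of c] by (auto split: if_splits)
  qed
  then obtain b' where b': "b = 2 * b'" by (rule evenE)
  have "odd (c^2)" using assms(1,3) \<open>even b\<close> by (metis even_add even_power pos2)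
  then have "odd c" by simp
  have "a^2 < c^2" using assms(1,4) by (simp flip: assms(1))
  then have "a < c" using power_less_imp_less_base by blast
  then have "even (c - a)" using \<open>odd c\<close> assms(3) by simp
  then obtain s where s: "c - a = 2 * s" by (rule evenE)
  define r where "r = s + a"
  have c: "c = r + s" "r = s + a" "s > 0" using s \<open>a < c\<close> by (auto simp: r_def)
  have "4 * b'^2 = 4 * (r * s)"
    using assms(1) b' c by (simp add: power2_eq_square algebra_simps)
  then have rs: "r * s = 1 * b'^2" by simp
  have "coprime r s"
  proof (rule coprimeI)
    fix l assume l: "l dvd r" "l dvd s"
    then have "l dvd a" using c by (metis dvd_add_right_iff)
    moreover have "l^2 dvd b'^2"
      using mult_dvd_mono[OF l] rs by (simp add: power2_eq_square)
    then have "l dvd b" using b' by simp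
    ultimately show "is_unit l" using assms(2) coprime_common_divisor by blast
  qed
  then obtain c' d m n where "1 = c' * d" "r = c' * m^2" "s = d * n^2"
    using coprime_mult_eq_mult_square rs c by (metis add_gr_0)
  then have mn: "r = m^2" "s = n^2" by simp_all
  have "b'^2 = (m * n)^2" using rs mn by (simp add: power_mult_distrib)
  then have "b' = m * n" using power2_eq_imp_eq by blast
  moreover have "coprime m n" using \<open>coprime r s\<close> mn by simp
  ultimately show ?thesis using that[of m n] mn c b' by auto
qed

section \<open>Quadratic residues and fourth powers modulo a prime\<close>

text \<open>If \<open>l\<close> did not divide \<open>u\<close>, then \<open>a\<close> times the
  inverse of \<open>u\<close> would be a square root of \<open>k\<close> modulo
  \<open>l\<close>.\<close>

lemma nonresidue_mult_square_cong_square: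
  fixes l k u a :: int
  assumes "prime l" "quadratic_nonresidue l k" "[k * u^2 = a^2] (mod l)"
  shows "l dvd a"
proof -
  have "l dvd u"
  proof (rule ccontr)
    assume "\<not> l dvd u"
    then have "coprime u l" using assms(1) by (metis coprime_commute prime_imp_coprime)
    then obtain v where v: "[u * v = 1] (mod l)" using cong_solve_coprime_int by blast
    have "[(a * v)^2 = k * (u * v)^2] (mod l)"
      using cong_scalar_right[OF assms(3), of "v^2"] by (simp add: power_mult_distrib ac_simps cong_sym)
    also have "[k * (u * v)^2 = k * 1^2] (mod l)"
      by (intro cong_scalar_left cong_pow v)
    finally have "QuadRes l k" by (auto simp: QuadRes_def)
    then show False using assms(2) by (simp add: quadratic_nonresidue_def)
  qed
  then have "l dvd a^2"
    using cong_dvd_iff[OF assms(3)] by (simp add: power2_eq_square)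
  then show ?thesis using assms(1) prime_dvd_power by blast
qed

text \<open>Once \<open>l\<close> divides one of \<open>m\<close>, \<open>n\<close>, the sum is
  congruent to the square of the other, which must then vanish modulo \<open>l\<close> as
  well.\<close>

lemma nonresidue_sum_squares:
  fixes l k u m n :: int
  assumes "prime l" "quadratic_nonresidue l k" "[k * u^2 = m^2 + n^2] (mod l)" "l dvd m * n"
  shows "l dvd m \<and> l dvd n"
proof -
  have *: "l dvd b" if "l dvd a" "[k * u^2 = a^2 + b^2] (mod l)" for a b
  proof (rule nonresidue_mult_square_cong_square[OF assms(1,2)])
    have "[a^2 + b^2 = 0 + b^2] (mod l)"
      using that(1) by (intro cong_add) (auto simp: cong_0_iff power2_eq_square)
    then show "[k * u^2 = b^2] (mod l)" using that(2) cong_trans by fastforce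
  qed
  have "l dvd m \<or> l dvd n" using assms(1,4) by (simp add: prime_dvd_mult_iff)
  then show ?thesis using * assms(3) by (metis add.commute)
qed

text \<open>Euler's criterion with the even exponent \<open>(l - 1) div 2\<close>.\<close>

lemma minus_one_residue:
  assumes "prime (l::nat)" "[l = 1] (mod 4)"
  obtains i :: int where "[i^2 = -1] (mod int l)"
proof -
  have l: "l mod 4 = 1" using assms(2) by (simp add: cong_def)
  have "l > 2" using prime_ge_2_nat[OF assms(1)] l by (cases "l = 2") auto
  have "even ((l - 1) div 2)" using l by presburger
  then have L: "[Legendre (-1) (int l) = 1] (mod int l)"
    using euler_criterion[OF assms(1) \<open>l > 2\<close>, of "-1"] by simp
  have "QuadRes (int l) (-1)"
  proof (rule ccontr)
    assume "\<not> QuadRes (int l) (-1)"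
    then have "Legendre (-1) (int l) \<in> {0, -1}" by (simp add: Legendre_def)
    then have "int l dvd 1 \<or> int l dvd 2"
      using L by (auto simp: cong_iff_dvd_diff)
    then have "int l \<le> 2" by (auto dest: zdvd_imp_le)
    then show False using \<open>l > 2\<close> by simp
  qed
  then show ?thesis using that by (auto simp: QuadRes_def)
qed

text \<open>With \<open>i\<close> a square root of -1 modulo \<open>l\<close>, the difference
  becomes the sum \<open>m^2 + (i * n)^2\<close>.\<close>

lemma nonresidue_diff_squares:
  fixes l :: nat and k u m n :: int
  assumes "prime l" "[l = 1] (mod 4)" "quadratic_nonresidue (int l) k"
    "[k * u^2 = m^2 - n^2] (mod int l)" "int l dvd m * n"
  shows "int l dvd m \<and> int l dvd n"
proof -
  have prime: "prime (int l)" using assms(1) by simp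
  obtain i where i: "[i^2 = -1] (mod int l)" using minus_one_residue assms(1,2) by blast
  have "\<not> int l dvd i"
  proof
    assume "int l dvd i"
    then have "int l dvd -1" using cong_dvd_iff[OF i] by (simp add: power2_eq_square)
    then show False using prime not_prime_unit by auto
  qed
  have "[m^2 + i^2 * n^2 = m^2 + (-1) * n^2] (mod int l)"
    by (intro cong_add cong_mult i cong_refl)
  then have "[k * u^2 = m^2 + (i * n)^2] (mod int l)"
    using assms(4) by (simp add: power_mult_distrib cong_def)
  moreover have "int l dvd m * (i * n)"
    using assms(5) by (metis dvd_mult mult.left_commute)
  ultimately have "int l dvd m \<and> int l dvd i * n"
    using nonresidue_sum_squares prime assms(3) by blast
  then show ?thesis using \<open>\<not> int l dvd i\<close> prime by (simp add: prime_dvd_mult_iff)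
qed

lemma prime_dvd_sum_fourth_powers:
  fixes q u v :: nat
  assumes "prime q" "[q = 5] (mod 8)" "q dvd u^4 + v^4"
  shows "q dvd u"
proof (rule ccontr)
  assume u: "\<not> q dvd u"
  have v: "\<not> q dvd v"
  proof
    assume "q dvd v"
    then have "q dvd v^4" by (simp add: dvd_power_same dvd_trans)
    then have "q dvd u^4" using assms(3) by (simp add: dvd_add_left_iff)
    then show False using u assms(1) prime_dvd_power by blast
  qed
  have q: "q mod 8 = 5" using assms(2) by (simp add: cong_def)
  define j where "j = q div 8"
  \<comment> \<open>The exponent \<open>(q - 1) / 4\<close> is odd, so raising
    \<open>u^4 = - v^4\<close> to it keeps the sign, and Fermat's theorem turns the result into 1 =
    -1 modulo \<open>q\<close>.\<close>
  have qj: "q - 1 = 4 * (2 * j + 1)" using q unfolding j_def by presburger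
  have "int q dvd int u^4 + int v^4" using assms(3) by (metis int_dvd_int_iff of_nat_add of_nat_power)
  then have "[int u^4 = - (int v^4)] (mod int q)" by (simp add: cong_iff_dvd_diff)
  then have "[(int u^4)^(2 * j + 1) = (- (int v^4))^(2 * j + 1)] (mod int q)" by (rule cong_pow)
  then have *: "[int u^(q - 1) = - (int v^(q - 1))] (mod int q)"
    unfolding qj power_mult by simp
  have "[int u^(q - 1) = 1] (mod int q)" "[int v^(q - 1) = 1] (mod int q)"
    using fermat_theorem[OF assms(1)] u v
    by (metis cong_int_iff of_nat_1 of_nat_power)+
  then have "[1 = - 1] (mod int q)"
    using * by (meson cong_minus_minus_iff cong_sym cong_trans)
  then have "int q dvd 2" by (simp add: cong_iff_dvd_diff)
  then have "q \<le> 2" using zdvd_imp_le by fastforce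
  then show False using q by (cases "q = 2") auto
qed

text \<open>As \<open>p\<close> is 1 modulo 4, the sign in quadratic reciprocity is +1 and the two
  Legendre symbols agree.\<close>

lemma nonresidue_reciprocity:
  fixes p q :: nat
  assumes "prime p" "prime q" "odd q" "[p = 1] (mod 4)" "quadratic_nonresidue (int q) (int p)"
  shows "quadratic_nonresidue (int p) (int q)"
proof -
  have pm: "p mod 4 = 1" using assms(4) by (simp add: cong_def)
  have "2 < p" using prime_ge_2_nat[OF assms(1)] pm by (cases "p = 2") auto
  have "2 < q" using prime_ge_2_nat[OF assms(2)] assms(3) by (cases "q = 2") auto
  have nd: "\<not> q dvd p" using assms(5) by (simp add: quadratic_nonresidue_def)
  then have "p \<noteq> q" by auto
  have "even ((p - 1) div 2 * ((q - 1) div 2))" using pm by (simp, presburger)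
  then have "Legendre (int p) (int q) * Legendre (int q) (int p) = 1"
    using Quadratic_Reciprocity[OF assms(1) \<open>2 < p\<close> assms(2) \<open>2 < q\<close> \<open>p \<noteq> q\<close>]
    by simp
  moreover have "Legendre (int p) (int q) = -1"
    using assms(5) by (simp add: Legendre_def quadratic_nonresidue_def cong_0_iff)
  ultimately have "Legendre (int q) (int p) = -1" by simp
  then show ?thesis
    by (auto simp: Legendre_def quadratic_nonresidue_def cong_0_iff split: if_splits)
qed

lemma dvd_prime_mult_primeE:
  fixes p q c d :: nat
  assumes "prime p" "prime q" "p * q = c * d"
  obtains "c = 1" "d = p * q" | "c = p" "d = q" | "c = q" "d = p" | "c = p * q" "d = 1"
proof -
  have "p > 0" "q > 0" using assms prime_gt_0_nat by auto
  have "p dvd c * d" using assms(3) by (metis dvd_triv_left)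
  then consider "p dvd c" | "p dvd d" using assms(1) by (auto simp: prime_dvd_mult_iff)
  then show ?thesis
  proof cases
    case 1
    then obtain e where e: "c = p * e" by (auto simp: dvd_def)
    then have "q = e * d" using assms(3) \<open>p > 0\<close> by simp
    then show ?thesis using e that prime_product[of e d] assms(2) by auto
  next
    case 2
    then obtain e where e: "d = p * e" by (auto simp: dvd_def)
    then have "q = c * e" using assms(3) \<open>p > 0\<close> by simp
    then show ?thesis using e that prime_product[of c e] assms(2) by auto
  qed
qed

section \<open>Cases excluded before the descent\<close>

text \<open>The triple gives \<open>k * u^2 = m^2 - n^2\<close> and
  \<open>l * v^2 = 2 * m * n\<close>. The odd prime \<open>l\<close> thus divides
  \<open>m * n\<close>, hence both \<open>m\<close> and \<open>n\<close>, against
  coprimality.\<close>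

lemma no_mixed_sum_square:
  fixes k l u v t :: nat
  assumes "prime l" "[l = 1] (mod 4)" "quadratic_nonresidue (int l) (int k)"
    "(k * u^2)^2 + (l * v^2)^2 = t^2" "coprime (k * u^2) (l * v^2)" "odd (k * u^2)" "v > 0"
  shows False
proof -
  have "l * v^2 > 0" using assms prime_gt_0_nat by simp
  then obtain m n where mn: "coprime m n" "k * u^2 + n^2 = m^2" "l * v^2 = 2 * m * n"
    using primitive_pythagorean_triple[OF assms(4-6)] by metis
  have "l mod 4 = 1" using assms(2) by (simp add: cong_def)
  then have "\<not> l dvd 2" using assms(1) primes_dvd_imp_eq[of l 2] by auto
  then have "l dvd m * n"
    using mn(3) assms(1) by (metis dvd_triv_left mult.assoc prime_dvd_mult_iff)
  then have "int l dvd int m * int n" by (metis int_dvd_int_iff of_nat_mult)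
  moreover have "int k * int u^2 = int m^2 - int n^2"
    using arg_cong[OF mn(2), of int] by simp
  ultimately have "int l dvd int m \<and> int l dvd int n"
    using nonresidue_diff_squares[OF assms(1-3), of "int u"] by (metis cong_refl)
  then show False using mn(1) assms(1)
    by (metis coprime_common_divisor_nat int_dvd_int_iff not_prime_1)
qed

text \<open>Here \<open>p * q * x^2\<close>, which is 5 modulo 8, is the odd leg and equals
  \<open>m^2 - n^2\<close> with \<open>2 * m * n = y^2\<close>. Then \<open>m = a^2\<close> and
  \<open>n = 2 * b^2\<close>, and the difference factors into \<open>a^2 + 2 * b^2\<close> and
  \<open>a^2 - 2 * b^2\<close>.\<close>

lemma no_primitive_solution_even:
  fixes p q x y z :: nat
  assumes "prime p" "prime q" "p mod 8 = 1" "q mod 8 = 5"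
    "coprime (p * q * x) y" "(p * q * x^2)^2 + y^4 = z^2" "y > 0" "even y"
  shows False
proof -
  have d: "p * q mod 8 = 5" using assms(3,4) by (metis mod_mult_eq mult_1 mod_mod_trivial)
  have "odd (p * q * x)" using assms(5,8) coprime_common_divisor odd_one by blast
  then have "odd x" and od: "odd (p * q * x^2)" by auto
  have "coprime (p * q * x^2) (y^2)" using assms(5) by simp
  moreover have "(p * q * x^2)^2 + (y^2)^2 = z^2" using assms(6) by (simp flip: power_mult)
  ultimately obtain m n where mn: "coprime m n" "n > 0" "p * q * x^2 + n^2 = m^2" "y^2 = 2 * m * n"
    using primitive_pythagorean_triple[of "p * q * x^2" "y^2" z] od assms(7) by (metis zero_less_power)
  have x8: "p * q * x^2 mod 8 = 5"
    using d odd_square_mod_8_nat[OF \<open>odd x\<close>] by (metis mod_mult_eq mult.right_neutral mod_mod_trivial)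
  have "even n"
  proof (rule ccontr)
    assume "odd n"
    then have "(p * q * x^2 + n^2) mod 4 = 2" using x8 square_mod_4_nat[of n] by presburger
    then show False using mn(3) square_mod_4_nat[of m] by (auto split: if_splits)
  qed
  then have "odd m" using mn(1) coprime_common_divisor odd_one by blast
  obtain y' where y': "y = 2 * y'" using assms(8) by (rule evenE)
  have "m * n = 2 * y'^2" using mn(4) y' by (simp add: power2_eq_square)
  then obtain c d a b where cd: "2 = c * d" "m = c * a^2" "n = d * b^2"
    using coprime_mult_eq_mult_square mn(1,2) \<open>odd m\<close> by (metis odd_pos)
  have "odd c" "odd a" using cd \<open>odd m\<close> by auto
  then have "c = 1" using cd(1) prime_product[of c d] by auto
  then have ab: "m = a^2" "n = 2 * b^2" using cd by auto
  have "(2 * b^2)^2 < (a^2)^2" using mn(3) odd_pos[OF od] unfolding ab by linarith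
  then have lt: "2 * b^2 < a^2" using power_less_imp_less_base by blast
  define e where "e = a^2 - 2 * b^2"
  have e: "a^2 = e + 2 * b^2" "e > 0" using lt by (auto simp: e_def)
  have "p * q * x^2 + (2 * b^2)^2 = (e + 2 * b^2)^2" using mn(3) ab e by simp
  then have prod: "(a^2 + 2 * b^2) * e = (p * q) * x^2"
    using e by (simp add: power2_eq_square algebra_simps)
  \<comment> \<open>The two factors differ by \<open>4 * b^2\<close>, which is coprime to the odd
    number \<open>e\<close>.\<close>
  have cop: "coprime (a^2 + 2 * b^2) e"
  proof -
    have "odd e" using arg_cong[OF e(1), of even] \<open>odd a\<close> by simp
    have "coprime (2 * b^2) (a^2)" using mn(1) ab by (simp add: coprime_commute)
    then have "coprime (2 * b^2) e" using e by (metis coprime_add_self_nat coprime_commute add.commute)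
    moreover have "coprime 2 e" using \<open>odd e\<close> by simp
    ultimately have "coprime (2 * (2 * b^2)) e" by (simp only: coprime_mult_left_iff)
    then have "coprime (2 * (2 * b^2) + e) e" by (simp only: coprime_add_self_nat)
    then show ?thesis using e by (simp add: algebra_simps)
  qed
  obtain c d s t where c: "p * q = c * d" "a^2 + 2 * b^2 = c * s^2"
    using coprime_mult_eq_mult_square[OF cop prod] e by (metis add_gr_0)
  txt \<open>The factor \<open>a\<^sup>2 + 2b\<^sup>2\<close> is \<open>1\<close> modulo \<open>4\<close>, which forces \<open>b\<close> to be even and \<open>pqx\<^sup>2 = a\<^sup>4 - 4b\<^sup>4\<close> to be \<open>1\<close> modulo \<open>8\<close>.\<close>
  have "c mod 4 = 1"
    by (rule dvd_prime_mult_primeE[OF assms(1,2) c(1)]) (use assms(3,4) d in presburger)+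
  moreover have "odd s" using c(2) \<open>odd a\<close> by (metis even_add even_mult_iff even_power dvd_triv_left pos2)
  then have "s^2 mod 4 = 1" by (simp add: square_mod_4_nat)
  ultimately have "(a^2 + 2 * b^2) mod 4 = 1"
    unfolding c(2) using mod_mult_eq[of c 4 "s^2"] by simp
  then have "even (b^2)" using square_mod_4_nat[of a] \<open>odd a\<close> by presburger
  then have "8 dvd n^2" unfolding ab(2) by (auto elim!: evenE simp: power_mult_distrib power2_eq_square)
  then have "m^2 mod 8 = 5"
    using x8 unfolding mn(3)[symmetric] by (elim dvdE) (simp only: mod_mult_self2)
  then show False using odd_square_mod_8_nat[OF \<open>odd m\<close>] by simp
qed

section \<open>Infinite descent on \<open>x\<close>\<close>

lemma no_primitive_solution:
  fixes p q x y z :: nat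
  assumes "prime p" "prime q" "p mod 8 = 1" "q mod 8 = 5"
    "quadratic_nonresidue (int q) (int p)"
    "x > 0" "y > 0" "coprime (p * q * x) y" "(p * q * x^2)^2 + y^4 = z^2"
  shows False
  using assms(6-)
proof (induction x arbitrary: y z rule: less_induct)
  case (less x)
  have p4: "[p = 1] (mod 4)" and q4: "[q = 1] (mod 4)"
    using assms(3,4) unfolding cong_def by presburger+
  have "odd p" "odd q" using assms(3,4) by presburger+
  have pos: "p > 0" "q > 0" using assms(1,2) prime_gt_0_nat by auto
  have nr: "quadratic_nonresidue (int p) (int q)"
    using nonresidue_reciprocity assms(1,2,5) \<open>odd q\<close> p4 by blast
  have "odd y" using no_primitive_solution_even assms(1-4) less.prems by blast
  have "coprime (y^2) (p * q * x^2)" using less.prems(3) by (simp add: coprime_commute)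
  moreover have "(y^2)^2 + (p * q * x^2)^2 = z^2"
    using less.prems(4) by (simp flip: power_mult)
  ultimately obtain m n where mn: "coprime m n" "n > 0" "y^2 + n^2 = m^2" "p * q * x^2 = 2 * m * n"
    using primitive_pythagorean_triple[of "y^2" "p * q * x^2" z] \<open>odd y\<close> less.prems(1) pos
    by (metis even_power nat_0_less_mult_iff zero_less_power)
  have "coprime y n"
  proof -
    have "coprime (m^2) (n^2)" using mn(1) by simp
    then have "coprime (y^2 + n^2) (n^2)" using mn(3) by simp
    then have "coprime (y^2) (n^2)" by (simp only: coprime_add_self_nat)
    then show ?thesis by simp
  qed
  \<comment> \<open>In the second triple \<open>y\<close> itself is the odd leg.\<close>
  then obtain r s where rs: "coprime r s" "s > 0" "y + s^2 = r^2" "n = 2 * r * s" "m = r^2 + s^2"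
    using primitive_pythagorean_triple[OF mn(3) _ \<open>odd y\<close> mn(2)] by metis
  have "r > 0" using rs(4) mn(2) by (cases r) auto
  have "even (p * q * x^2)" using mn(4) by simp
  then have "even x" using \<open>odd p\<close> \<open>odd q\<close> by auto
  then obtain w where w: "x = 2 * w" by (rule evenE)
  have prod: "(r^2 + s^2) * (r * s) = (p * q) * w^2"
    using mn(4) rs w by (simp add: power2_eq_square algebra_simps)
  have cop: "coprime (r^2 + s^2) (r * s)"
  proof -
    have "coprime (r^2 + s^2) (r^2)" "coprime (r^2 + s^2) (s^2)"
      using rs(1) coprime_add_self_nat[of "s^2" "r^2"] coprime_add_self_nat[of "r^2" "s^2"]
      by (simp_all add: ac_simps)
    then show ?thesis by (simp add: coprime_mult_right_iff)
  qed
  obtain c d t w' where c: "p * q = c * d" "r^2 + s^2 = c * t^2" "r * s = d * w'^2"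
    using coprime_mult_eq_mult_square[OF cop prod] \<open>r > 0\<close> rs(2) by (metis add_gr_0 nat_0_less_mult_iff zero_less_power)
  \<comment> \<open>For \<open>c = p\<close> or \<open>c = q\<close>: the other prime is
    \<open>d\<close>, so it divides \<open>r * s\<close>, while \<open>c\<close> is a nonresidue
    modulo it.\<close>
  have sum_nonres: False
    if "prime l" "quadratic_nonresidue (int l) (int k)" "r^2 + s^2 = k * t^2" "l dvd r * s" for k l
  proof -
    have "int k * int t^2 = int r^2 + int s^2" using arg_cong[OF that(3), of int] by simp
    moreover have "int l dvd int r * int s" using that(4) by (metis int_dvd_int_iff of_nat_mult)
    ultimately have "int l dvd int r \<and> int l dvd int s"
      using nonresidue_sum_squares[of "int l" "int k" "int t"] that(1,2)
      by (metis cong_refl prime_nat_int_transfer)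
    then show False using rs(1) that(1)
      by (metis coprime_common_divisor_nat int_dvd_int_iff not_prime_1)
  qed
  from assms(1,2) c(1) show False
  proof (cases rule: dvd_prime_mult_primeE)
    case 1
    obtain a b u v where ab: "p * q = a * b" "r = a * u^2" "s = b * v^2"
      using coprime_mult_eq_mult_square[OF rs(1), of "p * q" w'] c(3) 1 \<open>r > 0\<close> rs(2) by metis
    have uv: "u > 0" "v > 0" using \<open>r > 0\<close> rs(2) ab by (auto intro!: Nat.gr0I)
    have t: "r^2 + s^2 = t^2" using c(2) 1 by simp
    have rsw: "r * s = p * q * w'^2" using c(3) 1 by simp
    have "p * q * w^2 = p * q * (t * w')^2"
      unfolding prod[symmetric] t rsw by (simp add: power_mult_distrib)
    then have "w = t * w'" using pos by simp
    have "p * q * (u * v)^2 = r * s"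
      by (simp add: ab power_mult_distrib)
    then have "w' = u * v" using rsw pos by simp
    \<comment> \<open>Altogether \<open>x = 2 * t * u * v\<close>, so \<open>u\<close> and
      \<open>v\<close> are both smaller than \<open>x\<close> and either can serve in the
      descent.\<close>
    have "t > 0" using t rs(2) by (cases t) auto
    have "u < x" "v < x"
    proof -
      have "x = u * (2 * (t * v))" "x = v * (2 * (t * u))"
        using w \<open>w = t * w'\<close> \<open>w' = u * v\<close> by simp_all
      moreover have "t * v > 0" "t * u > 0" using \<open>t > 0\<close> uv by simp_all
      then have "Suc 0 < 2 * (t * v)" "Suc 0 < 2 * (t * u)" by linarith+
      ultimately show "u < x" "v < x" using uv n_less_n_mult_m by metis+
    qed
    \<comment> \<open>Either of \<open>r\<close>, \<open>s\<close> may be the odd leg, so the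
      nonresidue condition enters in both directions.\<close>
    have mixed: False
      if "prime k" "prime l" "[k = 1] (mod 4)" "[l = 1] (mod 4)"
        "quadratic_nonresidue (int l) (int k)" "quadratic_nonresidue (int k) (int l)"
        "r = k * u^2" "s = l * v^2" for k l
    proof (cases "odd r")
      case True
      then show False using no_mixed_sum_square[of l k u v t] that t rs(1) uv by blast
    next
      case False
      then have "odd s" using rs(1) coprime_common_divisor odd_one by blast
      moreover have "s^2 + r^2 = t^2" using t by (simp only: add.commute)
      moreover have "coprime s r" using rs(1) by (simp only: coprime_commute)
      ultimately show False using no_mixed_sum_square[of k l v u t] that uv by blast
    qed
    from assms(1,2) ab(1) show False
    proof (cases rule: dvd_prime_mult_primeE)
      case 1
      \<comment> \<open>Here \<open>r = u^2\<close> and \<open>s = p * q * v^2\<close>, so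
        \<open>r^2 + s^2 = t^2\<close> is the original equation with \<open>v\<close>,
        \<open>u\<close>, \<open>t\<close> for \<open>x\<close>, \<open>y\<close>,
        \<open>z\<close>.\<close>
      have "(p * q * v^2)^2 + u^4 = t^2"
        using t ab(2,3) 1 by (simp add: add.commute flip: power_mult)
      moreover have "coprime (p * q * v) u" using rs(1) ab(2,3) 1 by (simp add: coprime_commute)
      ultimately show False using less.IH[of v u t] \<open>v < x\<close> uv by blast
    next
      case 2
      then show False using mixed[of p q] ab(2,3) assms nr p4 q4 by blast
    next
      case 3
      then show False using mixed[of q p] ab(2,3) assms nr p4 q4 by blast
    next
      case 4
      have "(p * q * u^2)^2 + v^4 = t^2"
        using t ab(2,3) 4 by (simp flip: power_mult)
      moreover have "coprime (p * q * u) v" using rs(1) ab(2,3) 4 by simp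
      ultimately show False using less.IH[of u v t] \<open>u < x\<close> uv by blast
    qed
  next
    case 2
    then show False using sum_nonres[of q p] assms(2,5) c(2,3) by simp
  next
    case 3
    then show False using sum_nonres[of p q] assms(1) nr c(2,3) by simp
  next
    case 4
    then obtain a b u v where ab: "1 = a * b" "r = a * u^2" "s = b * v^2"
      using coprime_mult_eq_mult_square[OF rs(1), of 1 w'] c(3) \<open>r > 0\<close> rs(2) by auto
    \<comment> \<open>With \<open>c = p * q\<close> the sum \<open>r^2 + s^2\<close> is
      \<open>u^4 + v^4\<close> and is divisible by \<open>q\<close>.\<close>
    then have sq: "r = u^2" "s = v^2" by simp_all
    then have "q dvd u^4 + v^4" "q dvd v^4 + u^4" using c(2) 4 by (simp_all add: ac_simps flip: power_mult)
    moreover have "[q = 5] (mod 8)" using assms(4) by (simp add: cong_def)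
    ultimately have "q dvd u" "q dvd v" using prime_dvd_sum_fourth_powers[OF assms(2)] by blast+
    moreover have "coprime u v" using rs(1) unfolding sq by simp
    ultimately have "is_unit q" using coprime_common_divisor by blast
    then show False using assms(2) not_prime_unit by blast
  qed
qed

theorem theorem4:
  fixes p q :: nat
  assumes "prime p" and "prime q"
    and "[p = 1] (mod 8)" and "[q = 5] (mod 8)"
    and "quadratic_nonresidue (int q) (int p)"
  shows "(\<exists>x y z :: nat. x > 0 \<and> y > 0 \<and> z > 0 \<and> gcd (p * q * x) y = 1 \<and>
            (p * q * x^2)^2 + y^4 = z^2) \<longleftrightarrow>
         (\<exists>x y z :: nat. x > 0 \<and> y > 0 \<and> z > 0 \<and> gcd x y = 1 \<and>
            p * q * z^2 = x^4 + y^4)"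
proof -
  have lhs: "False" if "x > 0" "y > 0" "gcd (p * q * x) y = 1" "(p * q * x^2)^2 + y^4 = z^2" for x y z :: nat
  proof (rule no_primitive_solution[OF assms(1,2) _ _ assms(5) that(1,2) _ that(4)])
    show "coprime (p * q * x) y" using that(3) by (simp only: coprime_iff_gcd_eq_1)
  qed (use assms(3,4) in \<open>simp_all add: cong_def\<close>)
  have rhs: "False" if "gcd x y = 1" "p * q * z^2 = x^4 + y^4" for x y z :: nat
  proof -
    have "q dvd x^4 + y^4" "q dvd y^4 + x^4"
      using that(2) by (metis add.commute dvd_mult dvd_mult2 dvd_refl)+
    then have "q dvd gcd x y" using prime_dvd_sum_fourth_powers[OF assms(2,4)] by (meson gcd_greatest)
    then show False using that(1) assms(2) by (metis nat_dvd_1_iff_1 not_prime_1)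
  qed
  \<comment> \<open>Each direction starts from a contradiction. The numbers \<open>(3)\<close> and
    \<open>(1)\<close> count the further premises of \<open>lhs\<close> and \<open>rhs\<close>
    solved by assumption.\<close>
  show ?thesis by (intro iffI; elim exE conjE) (drule (3) lhs, erule FalseE, drule (1) rhs, erule FalseE)
qed

end
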